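(* Let $d\ge2$, let $C\in\mathcal{C}_{ar}^d$ be a $d$-dimensional Archimedean copula and let $\gamma\in\mathcal{P}_{\mathcal{W}_d}$ be its corresponding Williamson measure. Then $\gamma$ has full support $[0,\infty)$ if and only if $C$ has full support $\mathbb{I}^d$ (i.e. $\mathrm{supp}(\mu_C)=\mathbb{I}^d$).
   Context: Notation: $\mathbb{I}=[0,1]$; conventions $\inf\emptyset=\infty$, $1/\infty=0$, $1/0=\infty$. The support of a finite Borel measure is the complement of the union of all open sets of measure $0$. $\mu_C$ is the probability measure on $\mathbb{I}^d$ with distribution function $C$. A generator is a continuous non-increasing $\psi:[0,\infty)\to\mathbb{I}$ with $\psi(0)=1$, $\psi(\infty):=\lim_{z\to\infty}\psi(z)=0$, strictly decreasing on $[0,\inf\{x:\psi(x)=0\})$; its pseudo-inverse is $\varphi(y)=\inf\{z\in[0,\infty]:\psi(z)=y\}$, $y\in\mathbb{I}$. All generators are normalized by $\psi(1)=\frac12$. A $d$-dimensional Archimedean copula is a copula of the form $C(\mathbf{x})=\psi(\sum_{i=1}^d\varphi(x_i))$; this function is a copula iff $\psi$ is $d$-monotone, i.e. (with $\psi$ continuous on $[0,\infty)$) on $(0,\infty)$ $\psi$ is differentiable up to order $d-2$, $(-1)^k\psi^{(k)}\ge0$ for $k\le d-2$, and $(-1)^{d-2}\psi^{(d-2)}$ is non-increasing and convex. $\mathcal{C}_{ar}^d$ is the set of all $d$-dimensional Archimedean copulas. $\mathcal{P}_{\mathcal{W}_d}$ is the set of Borel probability measures $\gamma$ on $[0,\infty)$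 with $\gamma(\{0\})=0$ and $\int_{[0,1]}(1-t)^{d-1}d\gamma(t)=\frac12$. The map $\gamma\mapsto\psi$, $\psi(z)=\int_{[0,\infty)}(1-tz)_+^{d-1}d\gamma(t)$, is a bijection from $\mathcal{P}_{\mathcal{W}_d}$ onto the normalized $d$-monotone generators, and $\psi\mapsto C$ is a bijection onto $\mathcal{C}_{ar}^d$; the $\gamma$ associated in this way with $C$ is its Williamson measure. *)

theory Defs
  imports "HOL-Probability.Probability"
begin

text \<open>
  Measures on a Borel subset \<open>A\<close> of a space are measures over \<open>restrict_space borel A\<close>.
  Functions on \<open>[0,\<infinity>)\<close> or on the unit cube are total functions whose values elsewhere are
  never used.
\<close>

definition msupport :: "'a::topological_space measure \<Rightarrow> 'a set" where
  "msupport M = space M - \<Union>{U. openin (top_of_set (space M)) U \<and> emeasure M U = 0}"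

definition has_cdf :: "(real^'d) measure \<Rightarrow> (real^'d \<Rightarrow> real) \<Rightarrow> bool" where
  "has_cdf M C \<longleftrightarrow>
     prob_space M \<and>
     sets M = sets (restrict_space borel (cbox 0 1)) \<and>
     (\<forall>x\<in>cbox 0 1. measure M (cbox 0 x) = C x)"

text \<open>
  A copula is the distribution function of a probability measure on the unit cube all of
  whose univariate margins are uniform.
\<close>

definition copula :: "(real^'d \<Rightarrow> real) \<Rightarrow> bool" where
  "copula C \<longleftrightarrow>
     (\<exists>M. has_cdf M C) \<and>
     (\<forall>i. \<forall>u\<in>{0..1}. C (\<chi> j. if j = i then u else 1) = u)"

definition copula_measure :: "(real^'d \<Rightarrow> real) \<Rightarrow> (real^'d) measure" where
  "copula_measure C = (THE M. has_cdf M C)"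

text \<open>Generators are normalized by \<open>\<psi> 1 = 1/2\<close>; the infimum below is \<open>\<infinity>\<close> if \<open>\<psi>\<close> has no zero.\<close>

definition generator :: "(real \<Rightarrow> real) \<Rightarrow> bool" where
  "generator \<psi> \<longleftrightarrow>
     continuous_on {0..} \<psi> \<and>
     \<psi> ` {0..} \<subseteq> {0..1} \<and>
     antimono_on {0..} \<psi> \<and>
     \<psi> 0 = 1 \<and>
     (\<psi> \<longlongrightarrow> 0) at_top \<and>
     strict_antimono_on {x. 0 \<le> x \<and> ennreal x < Inf (ennreal ` {z. 0 \<le> z \<and> \<psi> z = 0})} \<psi> \<and>
     \<psi> 1 = 1/2"

text \<open>Extension of a generator to \<open>[0,\<infinity>]\<close> by its limit \<open>0\<close> at infinity.\<close>

definition gen_ext :: "(real \<Rightarrow> real) \<Rightarrow> ennreal \<Rightarrow> real" where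
  "gen_ext \<psi> z = (if z = \<infinity> then 0 else \<psi> (enn2real z))"

definition pseudo_inverse :: "(real \<Rightarrow> real) \<Rightarrow> real \<Rightarrow> ennreal" where
  "pseudo_inverse \<psi> y = Inf {z. gen_ext \<psi> z = y}"

definition arch_fun :: "(real \<Rightarrow> real) \<Rightarrow> real^'d \<Rightarrow> real" where
  "arch_fun \<psi> x = gen_ext \<psi> (\<Sum>i\<in>UNIV. pseudo_inverse \<psi> (x $ i))"

definition archimedean_copulas :: "(real^'d \<Rightarrow> real) set" where
  "archimedean_copulas =
     {C. copula C \<and> (\<exists>\<psi>. generator \<psi> \<and> (\<forall>x\<in>cbox 0 1. C x = arch_fun \<psi> x))}"

definition williamson_measures :: "nat \<Rightarrow> real measure set" where
  "williamson_measures d =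
     {\<gamma>. prob_space \<gamma> \<and> sets \<gamma> = sets (restrict_space borel {0..}) \<and>
         emeasure \<gamma> {0} = 0 \<and> (LINT t:{0..1}|\<gamma>. (1 - t) ^ (d - 1)) = 1/2}"

definition williamson_transform :: "nat \<Rightarrow> real measure \<Rightarrow> real \<Rightarrow> real" where
  "williamson_transform d \<gamma> z = (LINT t|\<gamma>. (max 0 (1 - t * z)) ^ (d - 1))"

text \<open>
  Both links between \<open>\<gamma>\<close>, the normalized generator \<open>\<psi>\<close> and the copula \<open>C\<close> are one-to-one, so for
  given \<open>C\<close> at most one \<open>\<gamma>\<close> satisfies this predicate.
\<close>

definition is_williamson_measure :: "(real^'d \<Rightarrow> real) \<Rightarrow> real measure \<Rightarrow> bool" where
  "is_williamson_measure C \<gamma> \<longleftrightarrow>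
     \<gamma> \<in> williamson_measures CARD('d) \<and>
     (\<exists>\<psi>. generator \<psi> \<and>
          (\<forall>z\<ge>0. \<psi> z = williamson_transform CARD('d) \<gamma> z) \<and>
          (\<forall>x\<in>cbox 0 1. C x = arch_fun \<psi> x))"

end

theory Submission imports Defs begin

text \<open>
  In the coordinates \<open>u\<^sub>i = \<psi>(x\<^sub>i)\<close>, the copula measure of a box
  \<open>\<Prod>(\<psi>(a\<^sub>i + h\<^sub>i), \<psi>(a\<^sub>i)]\<close> is the \<open>d\<close>-fold difference of \<open>\<psi>\<close> at \<open>\<Sum>a\<^sub>i\<close> with steps \<open>h\<^sub>i\<close>,
  hence the \<open>\<gamma>\<close>-integral of the \<open>d\<close>-fold difference of the kernel \<open>s \<mapsto> (1 - ts)\<^sub>+\<^bsup>d-1\<^esup>\<close>.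
  That difference is positive if \<open>\<Sum>a\<^sub>i < 1/t < \<Sum>(a\<^sub>i + h\<^sub>i)\<close> and zero otherwise, so boxes are
  charged by \<open>\<mu>\<^sub>C\<close> exactly if the corresponding intervals are charged by \<open>\<gamma>\<close>. Either full
  support hypothesis forces \<open>\<psi> > 0\<close>, which makes these coordinates cover the cube up to its boundary.
\<close>

section \<open>Iterated differences of the Williamson kernel\<close>

text \<open>The steps may differ, one for each coordinate of a box. The sign is opposite to that of
  the forward difference, so that differences up to order \<open>d\<close> of a
  \<open>d\<close>-monotone function are nonnegative.\<close>

primrec fdiff :: "real list \<Rightarrow> (real \<Rightarrow> real) \<Rightarrow> real \<Rightarrow> real" where
  "fdiff [] f s = f s"
| "fdiff (h # hs) f s = fdiff hs f s - fdiff hs f (s + h)"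

lemma fdiff_cmult: "fdiff hs (\<lambda>s. c * f s) s = c * fdiff hs f s"
  by (induction hs arbitrary: s) (auto simp: algebra_simps)

lemma has_real_derivative_fdiff:
  assumes "\<And>s. (f has_real_derivative f' s) (at s)"
  shows "(fdiff hs f has_real_derivative fdiff hs f' s) (at s)"
proof (induction hs arbitrary: s)
  case Nil
  have "fdiff [] f = f" by auto
  then show ?case using assms by simp
next
  case (Cons h hs)
  have "((\<lambda>s. fdiff hs f (s + h)) has_real_derivative fdiff hs f' (s + h)) (at s)"
    using Cons[of "s + h"] by (simp add: DERIV_shift)
  from DERIV_diff[OF Cons[of s] this]
  show ?case by simp
qed

lemma has_real_derivative_pos_part_power:
  assumes "n \<ge> 1"
  shows "((\<lambda>x::real. max 0 x ^ Suc n) has_real_derivative real (Suc n) * max 0 x ^ n) (at x)"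
proof -
  consider "x > 0" | "x < 0" | "x = 0" by linarith
  then show ?thesis
  proof cases
    case 1
    have "((\<lambda>x::real. x ^ Suc n) has_real_derivative real (Suc n) * max 0 x ^ n) (at x)"
      using 1 by (auto intro!: derivative_eq_intros simp del: power_Suc)
    then show ?thesis
      by (rule has_field_derivative_transform_within_open[where S = "{0<..}"]) (use 1 in auto)
  next
    case 2
    have "((\<lambda>x::real. 0) has_real_derivative real (Suc n) * max 0 x ^ n) (at x)"
      using 2 assms by (auto intro!: derivative_eq_intros)
    then show ?thesis
      by (rule has_field_derivative_transform_within_open[where S = "{..<0}"]) (use 2 in auto)
  next
    \<comment> \<open>At the kink the difference quotient is bounded by
      \<open>\<bar>h\<bar> ^ n\<close>, which tends to 0 because \<open>n \<ge> 1\<close>.\<close>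
    case 3
    have "(\<lambda>h::real. \<bar>h\<bar> ^ n) \<midarrow>0\<rightarrow> \<bar>0\<bar> ^ n"
      by (intro tendsto_intros)
    moreover have "\<bar>0::real\<bar> ^ n = 0" using assms by (simp add: power_0_left)
    ultimately have lim: "(\<lambda>h::real. \<bar>h\<bar> ^ n) \<midarrow>0\<rightarrow> 0" by metis
    have "(\<lambda>h::real. max 0 h ^ Suc n / h) \<midarrow>0\<rightarrow> 0"
      by (rule Lim_null_comparison[OF _ lim], rule always_eventually)
        (auto simp: max_def abs_mult)
    then show ?thesis
      using 3 assms by (simp add: DERIV_def power_0_left)
  qed
qed

lemma has_real_derivative_kernel:
  assumes "n \<ge> 1"
  shows "((\<lambda>s::real. max 0 (1 - t * s) ^ Suc n) has_real_derivative
           - (real (Suc n) * t) * max 0 (1 - t * s) ^ n) (at s)"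
proof -
  have "((\<lambda>s. 1 - t * s) has_real_derivative - t) (at s)"
    by (auto intro!: derivative_eq_intros)
  from DERIV_chain2[OF has_real_derivative_pos_part_power[OF assms] this]
  show ?thesis by (simp add: algebra_simps)
qed

text \<open>Induction on the exponent. Let \<open>g\<close> be the difference over all steps but the
  first, and \<open>S\<close> the sum of these steps. Its derivative is \<open>- c * k\<close> with
  \<open>c > 0\<close>, where \<open>k\<close> is the corresponding difference for the exponent
  lowered by one. By induction \<open>k\<close> is positive exactly on the interval from
  \<open>1/t - S\<close> to \<open>1/t\<close> and zero elsewhere. So \<open>g s - g (s + h)\<close>
  is positive exactly if this interval meets the one from \<open>s\<close> to
  \<open>s + h\<close>.\<close>

lemma fdiff_kernel:
  fixes t :: real
  assumes "t > 0" "n \<ge> 1" "length hs = Suc n" "\<forall>h\<in>set hs. h > 0"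
  shows "if t * s < 1 \<and> 1 < t * (s + sum_list hs)
         then fdiff hs (\<lambda>s. max 0 (1 - t * s) ^ n) s > 0
         else fdiff hs (\<lambda>s. max 0 (1 - t * s) ^ n) s = 0"
  using assms(2-4)
proof (induction n arbitrary: hs s rule: dec_induct)
  \<comment> \<open>This is the second difference of a convex, piecewise linear function whose only
    kink is at \<open>1/t\<close>.\<close>
  case base
  then obtain h k where hs: "hs = [h, k]" "h > 0" "k > 0"
    by (auto simp: length_Suc_conv)
  have "t * h > 0" "t * k > 0" using hs assms(1) by auto
  then show ?case by (auto simp: hs(1) max_def algebra_simps)
next
  case (step n)
  from step.prems obtain h ks where hs: "hs = h # ks" "h > 0" "length ks = Suc n" "\<forall>h\<in>set ks. h > 0"
    by (cases hs) auto
  define g where "g = fdiff ks (\<lambda>s. max 0 (1 - t * s) ^ Suc n)"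
  define k where "k = fdiff ks (\<lambda>s. max 0 (1 - t * s) ^ n)"
  define c where "c = real (Suc n) * t"
  have c: "c > 0" using assms(1) by (simp add: c_def)
  have k: "if t * x < 1 \<and> 1 < t * (x + sum_list ks) then k x > 0 else k x = 0" for x
    unfolding k_def by (rule step.IH[OF hs(3,4)])
  then have k_nonneg: "k x \<ge> 0" for x by (smt (verit))
  have deriv: "(g has_real_derivative - c * k x) (at x)" for x
    using has_real_derivative_fdiff[OF has_real_derivative_kernel[OF step.hyps(1), of t], of ks x]
    unfolding g_def k_def c_def fdiff_cmult .
  have decr: "g y \<le> g x" if "x \<le> y" for x y
    by (rule DERIV_nonpos_imp_nonincreasing[OF that]) (use deriv k_nonneg c in \<open>force simp: mult_le_0_iff\<close>)
  have mvt: "\<exists>z. x < z \<and> z < y \<and> g x - g y = (y - x) * (c * k z)" if "x < y" for x y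
    using MVT2[OF that, of g "\<lambda>x. - c * k x"] deriv by (auto simp: algebra_simps)
  have goal: "fdiff hs (\<lambda>s. max 0 (1 - t * s) ^ Suc n) s = g s - g (s + h)"
    by (simp add: hs(1) g_def)
  define S where "S = sum_list ks"
  have "S > 0"
    unfolding S_def using hs(3,4)
    by (cases ks) (auto intro!: add_pos_nonneg sum_list_nonneg simp: less_imp_le)
  have S: "sum_list hs = h + S" by (simp add: hs(1) S_def)
  show ?case
  proof (cases "t * s < 1 \<and> 1 < t * (s + sum_list hs)")
    case True
    then have 1: "s < 1/t" "1/t < s + h + S"
      using assms(1) by (auto simp: field_simps S)
    \<comment> \<open>\<open>l\<close> and \<open>r\<close> are the endpoints of the intersection of
      the intervals \<open>(s, s + h)\<close> and \<open>(1/t - S, 1/t)\<close>. A strict decrease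
      of \<open>g\<close> between them suffices, since \<open>g\<close> is non-increasing on the
      rest.\<close>
    define l where "l = max s (1/t - S)"
    define r where "r = min (s + h) (1/t)"
    have lr: "l < r" "s \<le> l" "r \<le> s + h"
      using 1 hs(2) \<open>S > 0\<close> by (auto simp: l_def r_def)
    from mvt[OF lr(1)] obtain z where z: "l < z" "z < r" "g l - g r = (r - l) * (c * k z)" by blast
    have "1/t - S < z" "z < 1/t" using z by (auto simp: l_def r_def)
    then have "t * z < 1 \<and> 1 < t * (z + S)" using assms(1) by (auto simp: field_simps)
    then have "k z > 0" using k[of z] by (simp add: S_def)
    then have "g l - g r > 0" unfolding z(3) using c lr(1) by simp
    then have "g s - g (s + h) > 0" using decr[OF lr(2)] decr[OF lr(3)] by linarith
    then show ?thesis using True unfolding goal by simp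
  next
    case False
    \<comment> \<open>Here the two intervals are disjoint, so \<open>k\<close> vanishes at whichever
      point the mean value theorem returns.\<close>
    from mvt[of s "s + h"] hs(2) obtain z where
      z: "s < z" "z < s + h" "g s - g (s + h) = h * (c * k z)" by auto
    have "\<not> (t * z < 1 \<and> 1 < t * (z + S))"
    proof
      assume *: "t * z < 1 \<and> 1 < t * (z + S)"
      have "t * s < t * z" "t * (z + S) < t * (s + (h + S))"
        using z assms(1) by auto
      with * False show False unfolding S by linarith
    qed
    then have "k z = 0" using k[of z] by (auto simp: S_def)
    then have "g s - g (s + h) = 0" unfolding z(3) by simp
    then show ?thesis using False unfolding goal by simp
  qed
qed

section \<open>Supports\<close>

lemma msupport_eq_space_iff:
  "msupport M = space M \<longleftrightarrow>
     (\<forall>U. openin (top_of_set (space M)) U \<and> emeasure M U = 0 \<longrightarrow> U = {})"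
  unfolding msupport_def using openin_subset by fastforce

lemma integral_pos_on:
  fixes f :: "'a \<Rightarrow> real"
  assumes "integrable M f" "AE x in M. 0 \<le> f x"
    and "A \<in> sets M" "emeasure M A \<noteq> 0" "\<And>x. x \<in> A \<Longrightarrow> 0 < f x"
  shows "0 < integral\<^sup>L M f"
proof -
  have "integral\<^sup>L M f \<noteq> 0"
  proof
    assume "integral\<^sup>L M f = 0"
    then have "AE x in M. f x = 0"
      using integral_nonneg_eq_0_iff_AE[OF assms(1,2)] by simp
    then have "AE x in M. x \<notin> A" by eventually_elim (use assms(5) in force)
    then show False
      using assms(3,4) AE_iff_null_sets by blast
  qed
  moreover have "0 \<le> integral\<^sup>L M f" by (rule integral_nonneg_AE[OF assms(2)])
  ultimately show ?thesis by simp
qed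

section \<open>Distribution functions on the unit cube\<close>

lemma space_has_cdf:
  assumes "has_cdf M C"
  shows "space M = cbox 0 1"
proof -
  have "sets M = sets (restrict_space borel (cbox 0 1))" using assms by (simp add: has_cdf_def)
  from sets_eq_imp_space_eq[OF this] show ?thesis by (simp add: space_restrict_space)
qed

text \<open>Only the coordinates in \<open>I\<close> have a lower bound, as the mass of a box is
  computed below by adding lower bounds one coordinate at a time.\<close>

lemma box_in_sets_has_cdf:
  fixes M :: "(real^'d) measure"
  assumes "has_cdf M C"
  shows "{u\<in>cbox 0 1. (\<forall>i\<in>I. p i < u $ i) \<and> (\<forall>i. u $ i \<le> q i)} \<in> sets M"
proof -
  have "{u::real^'d. (\<forall>i\<in>I. p i < u $ i) \<and> (\<forall>i. u $ i \<le> q i)} \<in> sets borel"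
    by measurable
  moreover have "{u\<in>cbox 0 1. (\<forall>i\<in>I. p i < u $ i) \<and> (\<forall>i. u $ i \<le> q i)}
      = cbox 0 1 \<inter> {u. (\<forall>i\<in>I. p i < u $ i) \<and> (\<forall>i. u $ i \<le> q i)}"
    by auto
  ultimately show ?thesis
    using assms unfolding has_cdf_def by (auto simp: sets_restrict_space)
qed

text \<open>Pushed forward to the whole space, both measures agree on the orthants
  \<open>{..a}\<close>, an intersection-stable generator of the Borel sets: such an orthant meets
  the cube in \<open>cbox 0 (inf a 1)\<close>, or not at all if \<open>a\<close> has a negative
  coordinate. This makes the description in \<open>copula_measure\<close> well defined.\<close>

lemma has_cdf_unique:
  fixes M N :: "(real^'d) measure"
  assumes "has_cdf M C" "has_cdf N C"
  shows "M = N"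
proof -
  have sets: "sets M = sets (restrict_space borel (cbox 0 1))" "sets N = sets M"
    and prob: "L \<in> {M, N} \<Longrightarrow> prob_space L"
    and cdf: "L \<in> {M, N} \<Longrightarrow> x \<in> cbox 0 1 \<Longrightarrow> measure L (cbox 0 x) = C x" for L x
    using assms by (auto simp: has_cdf_def)
  note sp = assms[THEN space_has_cdf]
  have meas: "(\<lambda>x. x) \<in> measurable L borel" if "L \<in> {M, N}" for L
  proof -
    have L: "sets L = sets (restrict_space borel (cbox 0 1))" using that sets by blast
    show ?thesis
      unfolding measurable_cong_sets[OF L refl] by (rule measurable_restrict_space1) simp
  qed
  have eq: "distr M borel (\<lambda>x. x) = distr N borel (\<lambda>x. x)"
  proof (rule measure_eqI_generator_eq[where E = "range atMost" and \<Omega> = UNIV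
        and A = "\<lambda>n. {..(\<chi> i. real n)}"])
    show "Int_stable (range (atMost :: real^'d \<Rightarrow> _))"
    proof (rule Int_stableI_image)
      fix a b :: "real^'d"
      have "{..a} \<inter> {..b} = {..inf a b}" by auto
      then show "\<exists>c\<in>UNIV. {..a} \<inter> {..b} = {..c}" by blast
    qed
    fix X :: "(real^'d) set" assume "X \<in> range atMost"
    then obtain a where X: "X = {..a}" by auto
    have "emeasure L ({..a} \<inter> cbox 0 1) = (if 0 \<le> a then C (inf a 1) else 0)"
      if L: "L \<in> {M, N}" for L
    proof (cases "0 \<le> a")
      case True
      then have "{..a} \<inter> cbox 0 1 = cbox 0 (inf a 1)"
        by (auto simp: cbox_interval)
      moreover have "0 \<le> (1::real^'d)" by (simp add: less_eq_vec_def)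
      then have "inf a 1 \<in> cbox 0 1" using True by (simp add: cbox_interval)
      ultimately show ?thesis
        using cdf[OF L] prob_space.finite_measure[THEN finite_measure.emeasure_eq_measure, OF prob[OF L]] True
        by simp
    next
      case False
      then have "{..a} \<inter> cbox 0 1 = {}" by (auto simp: cbox_interval)
      then show ?thesis using False by simp
    qed
    then show "emeasure (distr M borel (\<lambda>x. x)) X = emeasure (distr N borel (\<lambda>x. x)) X"
      using X by (simp add: emeasure_distr meas sp)
  next
    show "(\<Union>n. {..(\<chi> i. real n)}) = (UNIV :: (real^'d) set)"
    proof safe
      fix x :: "real^'d"
      obtain n where "norm x \<le> real n" using real_arch_simple by blast
      then have "x $ i \<le> real n" for i
        using component_le_norm_cart[of x i] by linarith
      then show "x \<in> (\<Union>n. {..(\<chi> i. real n)})" by (auto simp: less_eq_vec_def)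
    qed auto
    show "emeasure (distr M borel (\<lambda>x. x)) {..(\<chi> i. real n)} \<noteq> \<infinity>" for n
      using prob[of M] by (simp add: emeasure_distr[OF meas] finite_measure.emeasure_finite prob_space.finite_measure)
  qed (auto simp: borel_eq_atMost)
  show ?thesis
  proof (rule measure_eqI)
    fix A assume A: "A \<in> sets M"
    then have "A \<in> sets borel" "A \<subseteq> cbox 0 1"
      by (auto simp: sets sets_restrict_space)
    then show "emeasure M A = emeasure N A"
      using arg_cong[OF eq, of "\<lambda>L. emeasure L A"] by (simp add: emeasure_distr meas sp Int_absorb2)
  qed (use sets in simp)
qed

lemma has_cdf_copula_measure: "copula C \<Longrightarrow> has_cdf (copula_measure C) C"
  unfolding copula_def copula_measure_def by (metis has_cdf_unique theI)

section \<open>Generators\<close>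

lemma generator_bounds:
  assumes "generator \<psi>" "0 \<le> x"
  shows "0 \<le> \<psi> x" "\<psi> x \<le> 1"
  using assms by (auto simp: generator_def)

text \<open>Turns the domain of strictness, given by an infimum of zeros, into the condition
  \<open>\<psi> x > 0\<close>. If \<open>\<psi> z > 0\<close>, monotonicity puts all zeros to the
  right of \<open>z\<close> and continuity keeps them at a distance \<open>e\<close> from it, so
  \<open>z\<close> lies strictly below the infimum.\<close>

lemma generator_strict:
  assumes "generator \<psi>" "0 \<le> x" "x < y" "\<psi> x > 0"
  shows "\<psi> y < \<psi> x"
proof -
  have in_dom: "ennreal z < Inf (ennreal ` {z. 0 \<le> z \<and> \<psi> z = 0})" if z: "0 \<le> z" "\<psi> z > 0" for z
  proof -
    have "continuous (at z within {0..}) \<psi>"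
      using assms(1) z by (auto simp: generator_def continuous_on_eq_continuous_within)
    then obtain e where e: "e > 0" "\<And>w. w \<ge> 0 \<Longrightarrow> dist w z < e \<Longrightarrow> dist (\<psi> w) (\<psi> z) < \<psi> z"
      using z(2) unfolding continuous_within_eps_delta by fastforce
    have "z + e \<le> w" if w: "0 \<le> w" "\<psi> w = 0" for w
    proof (rule ccontr)
      assume "\<not> z + e \<le> w"
      moreover have "z < w"
        using assms(1) w z unfolding generator_def monotone_on_def
        by (metis atLeast_iff leI order.strict_iff_not)
      ultimately have "dist w z < e" by (auto simp: dist_real_def)
      from e(2)[OF w(1) this] w(2) z(2) show False by (auto simp: dist_real_def)
    qed
    then have "ennreal (z + e) \<le> Inf (ennreal ` {z. 0 \<le> z \<and> \<psi> z = 0})"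
      by (auto intro!: Inf_greatest ennreal_leI)
    moreover have "ennreal z < ennreal (z + e)" using e(1) z(1) by (auto simp: ennreal_less_iff)
    ultimately show ?thesis by simp
  qed
  show ?thesis
  proof (cases "\<psi> y > 0")
    case True
    then show ?thesis
      using in_dom[OF assms(2,4)] in_dom[of y] assms unfolding generator_def monotone_on_def by auto
  next
    case False
    then show ?thesis using assms(4) by simp
  qed
qed

text \<open>The infimum is over a single point: \<infinity> is excluded since \<open>gen_ext\<close>
  is 0 there, and strict decrease at positive values excludes any second real preimage.\<close>

lemma pseudo_inverse_generator:
  assumes "generator \<psi>" "0 \<le> x" "\<psi> x > 0"
  shows "pseudo_inverse \<psi> (\<psi> x) = ennreal x"
proof -
  have "{z. gen_ext \<psi> z = \<psi> x} = {ennreal x}"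
  proof safe
    fix z assume z: "gen_ext \<psi> z = \<psi> x"
    then have "z \<noteq> \<infinity>" using assms(3) by (auto simp: gen_ext_def)
    then have "\<psi> (enn2real z) = \<psi> x" using z by (auto simp: gen_ext_def)
    then have "enn2real z = x"
      using generator_strict[OF assms(1,2), of "enn2real z"]
        generator_strict[OF assms(1), of "enn2real z" x] assms(3)
      by (metis enn2real_nonneg less_irrefl linorder_neqE_linordered_idom)
    then show "z = ennreal x" using \<open>z \<noteq> \<infinity>\<close> by (auto simp: less_top)
  qed (use assms in \<open>auto simp: gen_ext_def\<close>)
  then show ?thesis by (simp add: pseudo_inverse_def)
qed

lemma arch_fun_generator:
  assumes "generator \<psi>" "\<And>i. 0 \<le> a i" "\<And>i. \<psi> (a i) > 0"
  shows "arch_fun \<psi> (\<chi> i. \<psi> (a i)) = \<psi> (\<Sum>i\<in>UNIV. a i)"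
  using assms by (simp add: arch_fun_def pseudo_inverse_generator gen_ext_def sum_nonneg)

lemma generator_range:
  assumes "generator \<psi>" "0 < y" "y < 1"
  obtains x where "0 < x" "\<psi> x = y"
proof -
  have "(\<psi> \<longlongrightarrow> 0) at_top" using assms(1) by (simp add: generator_def)
  from order_tendstoD(2)[OF this assms(2)] obtain N where N: "\<And>n. n \<ge> N \<Longrightarrow> \<psi> n < y"
    by (auto simp: eventually_at_top_linorder)
  have "\<exists>x\<ge>0. x \<le> max 0 N \<and> \<psi> x = y"
  proof (rule IVT2')
    show "\<psi> (max 0 N) \<le> y" using N[of "max 0 N"] by simp
    show "y \<le> \<psi> 0" using assms by (simp add: generator_def)
    show "continuous_on {0..max 0 N} \<psi>"
      using assms(1) unfolding generator_def by (auto intro: continuous_on_subset)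
  qed simp
  then obtain x where x: "x \<ge> 0" "\<psi> x = y" by blast
  then have "x \<noteq> 0" using assms by (auto simp: generator_def)
  with x that[of x] show ?thesis by simp
qed

section \<open>Mass of boxes in generator coordinates\<close>

text \<open>Induction on the list of coordinates with a lower bound. Without lower bounds the mass
  is a value of the distribution function, \<open>\<psi>\<close> of the sum of the
  \<open>a i\<close>. A lower bound in coordinate \<open>i\<close> removes the sub-box obtained by
  raising \<open>a i\<close> to \<open>a i + h i\<close>; this shifts the sum by \<open>h i\<close>,
  which is the recursion of \<open>fdiff\<close>.\<close>

lemma measure_box_fdiff:
  fixes M :: "(real^'d) measure" and a h :: "'d \<Rightarrow> real"
  assumes "has_cdf M C" "\<And>x. x \<in> cbox 0 1 \<Longrightarrow> C x = arch_fun \<psi> x" "generator \<psi>"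
    and pos: "\<And>x. 0 \<le> x \<Longrightarrow> \<psi> x > 0"
    and "\<And>i. 0 \<le> a i" "\<And>i. 0 < h i" "distinct is"
  shows "measure M {u\<in>cbox 0 1. (\<forall>i\<in>set is. \<psi> (a i + h i) < u $ i) \<and> (\<forall>i. u $ i \<le> \<psi> (a i))}
         = fdiff (map h is) \<psi> (\<Sum>i\<in>UNIV. a i)"
  using assms(5,7)
proof (induction "is" arbitrary: a)
  case Nil
  note le1 = generator_bounds(2)[OF assms(3)]
  define v :: "real^'d" where "v = (\<chi> i. \<psi> (a i))"
  have v: "v \<in> cbox 0 1"
    using Nil le1 pos by (auto simp: v_def mem_box_cart less_imp_le)
  have "{u\<in>cbox 0 1. \<forall>i. u $ i \<le> \<psi> (a i)} = cbox 0 v"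
    using Nil le1 unfolding v_def by (auto simp: mem_box_cart) (meson order_trans)
  then show ?case
    using assms(1-3) v Nil arch_fun_generator[of \<psi> a] pos by (simp add: has_cdf_def v_def)
next
  case (Cons i "is")
  define b where "b = a(i := a i + h i)"
  define S where
    "S a = {u\<in>cbox 0 1. (\<forall>i\<in>set is. \<psi> (a i + h i) < u $ i) \<and> (\<forall>i. u $ i \<le> \<psi> (a i))}" for a
  have b: "0 \<le> b j" for j using Cons.prems(1) assms(6)[of i] by (auto simp: b_def intro: add_nonneg_nonneg less_imp_le)
  interpret prob_space M using assms(1) by (simp add: has_cdf_def)
  have meas: "S a \<in> sets M" for a
    unfolding S_def by (rule box_in_sets_has_cdf[OF assms(1)])
  have less: "\<psi> (a i + h i) < \<psi> (a i)"
    using generator_strict[OF assms(3) Cons.prems(1)] assms(6) pos Cons.prems(1) by simp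
  \<comment> \<open>The list is distinct, so raising \<open>a\<close> at \<open>i\<close> leaves the
    lower faces already imposed unchanged.\<close>
  have ab: "a j = b j" if "j \<in> set is" for j using that Cons.prems(2) by (auto simp: b_def)
  have sub: "S b \<subseteq> S a"
  proof
    fix u assume u: "u \<in> S b"
    then have "u $ j \<le> \<psi> (b j)" for j by (simp add: S_def)
    moreover have "\<psi> (b j) \<le> \<psi> (a j)" for j using less by (simp add: b_def)
    ultimately have "u $ j \<le> \<psi> (a j)" for j by (rule order_trans)
    then show "u \<in> S a" using u ab by (auto simp: S_def)
  qed
  have Sb: "S b = {u\<in>S a. u $ i \<le> \<psi> (a i + h i)}"
  proof (intro equalityI subsetI)
    fix u assume "u \<in> S b"
    moreover from this have "u $ i \<le> \<psi> (b i)" by (simp add: S_def)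
    ultimately show "u \<in> {u\<in>S a. u $ i \<le> \<psi> (a i + h i)}" using sub by (auto simp: b_def)
  next
    fix u assume u: "u \<in> {u\<in>S a. u $ i \<le> \<psi> (a i + h i)}"
    then have "u $ j \<le> \<psi> (b j)" for j by (auto simp: S_def b_def)
    then show "u \<in> S b" using u ab by (auto simp: S_def)
  qed
  have "{u\<in>cbox 0 1. (\<forall>i\<in>set (i#is). \<psi> (a i + h i) < u $ i) \<and> (\<forall>i. u $ i \<le> \<psi> (a i))} = S a - S b"
    unfolding Sb by (auto simp: S_def)
  then have "measure M {u\<in>cbox 0 1. (\<forall>i\<in>set (i#is). \<psi> (a i + h i) < u $ i) \<and> (\<forall>i. u $ i \<le> \<psi> (a i))}
     = measure M (S a) - measure M (S b)"
    using finite_measure_Diff[OF meas meas sub] by simp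
  also have "measure M (S a) = fdiff (map h is) \<psi> (\<Sum>i\<in>UNIV. a i)"
    unfolding S_def using Cons by simp
  also have "measure M (S b) = fdiff (map h is) \<psi> (\<Sum>i\<in>UNIV. b i)"
    unfolding S_def using Cons b by simp
  also have "(\<Sum>i\<in>UNIV. b i) = (\<Sum>i\<in>UNIV. a i) + h i"
  proof -
    have "b j = a j + (if j = i then h i else 0)" for j by (auto simp: b_def)
    then show ?thesis by (simp add: sum.distrib)
  qed
  finally show ?case by simp
qed

section \<open>Williamson transforms\<close>

context
  fixes d :: nat and \<gamma> :: "real measure"
  assumes \<gamma>: "\<gamma> \<in> williamson_measures d"
begin

lemma williamson_prob_space: "prob_space \<gamma>"
  and sets_williamson: "sets \<gamma> = sets (restrict_space borel {0..})"
  using \<gamma> by (simp_all add: williamson_measures_def)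

lemma space_williamson: "space \<gamma> = {0..}"
  using sets_eq_imp_space_eq[OF sets_williamson] by (simp add: space_restrict_space)

lemma AE_williamson_pos: "AE t in \<gamma>. 0 < t"
proof -
  have "{0} \<in> null_sets \<gamma>"
    using \<gamma> by (auto simp: williamson_measures_def null_sets_def sets_restrict_space_iff)
  then have "AE t in \<gamma>. t \<notin> {0}" by (rule AE_not_in)
  then show ?thesis using AE_space by eventually_elim (auto simp: space_williamson)
qed

lemma greaterThanLessThan_in_sets_williamson: "0 \<le> a \<Longrightarrow> {a<..<b} \<in> sets \<gamma>"
  unfolding sets_williamson by (subst sets_restrict_space_iff) auto

lemma integrable_williamson_kernel:
  assumes "0 \<le> z"
  shows "integrable \<gamma> (\<lambda>t. (max 0 (1 - t * z)) ^ (d - 1))"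
proof -
  interpret prob_space \<gamma> by (rule williamson_prob_space)
  have "(\<lambda>t. (max 0 (1 - t * z)) ^ (d - 1)) \<in> borel_measurable (restrict_space borel {0..})"
    by (intro measurable_restrict_space1) measurable
  then have "(\<lambda>t. (max 0 (1 - t * z)) ^ (d - 1)) \<in> borel_measurable \<gamma>"
    by (simp add: measurable_cong_sets[OF sets_williamson refl])
  moreover have "AE t in \<gamma>. norm ((max 0 (1 - t * z)) ^ (d - 1)) \<le> 1"
    using AE_williamson_pos by eventually_elim (use assms in \<open>auto intro!: power_le_one\<close>)
  ultimately show ?thesis by (rule integrable_const_bound[rotated])
qed

lemma fdiff_williamson_transform:
  assumes "\<And>z. 0 \<le> z \<Longrightarrow> \<psi> z = williamson_transform d \<gamma> z" "0 \<le> s" "\<forall>h\<in>set hs. 0 < h"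
  shows "integrable \<gamma> (\<lambda>t. fdiff hs (\<lambda>s. (max 0 (1 - t * s)) ^ (d - 1)) s)"
    and "fdiff hs \<psi> s = (LINT t|\<gamma>. fdiff hs (\<lambda>s. (max 0 (1 - t * s)) ^ (d - 1)) s)"
proof -
  \<comment> \<open>Both claims go through one induction, since subtracting the integrals requires
    both integrands to be integrable.\<close>
  have "integrable \<gamma> (\<lambda>t. fdiff hs (\<lambda>s. (max 0 (1 - t * s)) ^ (d - 1)) s) \<and>
    fdiff hs \<psi> s = (LINT t|\<gamma>. fdiff hs (\<lambda>s. (max 0 (1 - t * s)) ^ (d - 1)) s)"
    using assms(2,3)
  proof (induction hs arbitrary: s)
    case Nil
    then show ?case
      using assms(1)[of s] integrable_williamson_kernel[of s] by (simp add: williamson_transform_def)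
  next
    case (Cons h hs)
    have "0 \<le> s + h" using Cons.prems by auto
    then show ?case using Cons.IH[of s] Cons.IH[of "s + h"] Cons.prems by simp
  qed
  then show "integrable \<gamma> (\<lambda>t. fdiff hs (\<lambda>s. (max 0 (1 - t * s)) ^ (d - 1)) s)"
    and "fdiff hs \<psi> s = (LINT t|\<gamma>. fdiff hs (\<lambda>s. (max 0 (1 - t * s)) ^ (d - 1)) s)"
    by auto
qed

lemma full_support_williamson_iff:
  "msupport \<gamma> = {0..} \<longleftrightarrow> (\<forall>a b. 0 < a \<longrightarrow> a < b \<longrightarrow> emeasure \<gamma> {a<..<b} \<noteq> 0)"
proof -
  have "msupport \<gamma> = {0..} \<longleftrightarrow>
     (\<forall>U. openin (top_of_set {0..}) U \<and> emeasure \<gamma> U = 0 \<longrightarrow> U = {})"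
    using msupport_eq_space_iff[of \<gamma>] by (simp add: space_williamson)
  also have "\<dots> \<longleftrightarrow> (\<forall>a b. 0 < a \<longrightarrow> a < b \<longrightarrow> emeasure \<gamma> {a<..<b} \<noteq> 0)"
  proof safe
    fix a b :: real assume *: "\<forall>U. openin (top_of_set {0..}) U \<and> emeasure \<gamma> U = 0 \<longrightarrow> U = {}"
      "0 < a" "a < b" "emeasure \<gamma> {a<..<b} = 0"
    have "openin (top_of_set {0..}) {a<..<b}"
      using *(2) by (auto simp: openin_open intro!: exI[of _ "{a<..<b}"])
    then show False using * by auto
  next
    fix U x assume *: "\<forall>a b. 0 < a \<longrightarrow> a < b \<longrightarrow> emeasure \<gamma> {a<..<b} \<noteq> 0"
      "openin (top_of_set {0..}) U" "emeasure \<gamma> U = 0" "x \<in> U"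
    obtain T where T: "open T" "U = {0..} \<inter> T" using *(2) by (auto simp: openin_open)
    then obtain e where e: "e > 0" "\<And>y. dist y x < e \<Longrightarrow> y \<in> T"
      using *(4) unfolding open_dist by blast
    have x: "x \<ge> 0" using *(4) T by auto
    \<comment> \<open>Only the right part of the neighbourhood is used: its left endpoint is
      positive even if \<open>x = 0\<close>.\<close>
    have "{x + e/2<..<x + e} \<subseteq> U"
      using e x by (auto simp: T(2) dist_real_def)
    moreover have "U \<in> sets \<gamma>"
      using T by (subst sets_williamson, subst sets_restrict_space_iff) auto
    ultimately have "emeasure \<gamma> {x + e/2<..<x + e} \<le> emeasure \<gamma> U" by (rule emeasure_mono)
    then show "x \<in> {}" using *(1,3) x e(1) by auto
  qed
  finally show ?thesis .
qed

end

section \<open>Full support of the copula and of its Williamson measure\<close>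

text \<open>Positivity spreads from \<open>\<psi> 1 = 1/2\<close> by doubling to all powers of 2,
  hence by monotonicity everywhere; a failure of the doubling would leave a corner of the cube at
  the origin without mass.\<close>

lemma generator_pos_of_full_copula:
  fixes C :: "real^'d \<Rightarrow> real"
  assumes "CARD('d) \<ge> 2" "has_cdf M C" "generator \<psi>" "\<And>x. x \<in> cbox 0 1 \<Longrightarrow> C x = arch_fun \<psi> x"
    and full: "msupport M = cbox 0 1" and "0 \<le> x"
  shows "\<psi> x > 0"
proof -
  note range = generator_bounds[OF assms(3)]
  have anti: "\<psi> y \<le> \<psi> x" if "0 \<le> x" "x \<le> y" for x y
    using assms(3) that unfolding generator_def monotone_on_def by auto
  note sp = space_has_cdf[OF assms(2)]
  \<comment> \<open>If \<open>\<psi>(2x) = 0 < \<psi>(x)\<close>, then \<open>C\<close> vanishes at the point \<open>(\<psi>(x), \<dots>, \<psi>(x))\<close>, as \<open>d \<ge> 2\<close>.\<close>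
  have double: "\<psi> (2 * x) > 0" if x: "0 \<le> x" "\<psi> x > 0" for x
  proof (rule ccontr)
    assume "\<not> \<psi> (2 * x) > 0"
    then have "\<psi> (real CARD('d) * x) \<le> 0"
      using anti[of "2 * x" "real CARD('d) * x"] x assms(1)
        mult_right_mono[of 2 "real CARD('d)" x] by simp
    then have zero: "\<psi> (real CARD('d) * x) = 0" using range(1)[of "real CARD('d) * x"] x by simp
    define u :: "real^'d" where "u = (\<chi> i. \<psi> x)"
    have u: "u \<in> cbox 0 1" using range x by (simp add: u_def mem_box_cart)
    have "C u = 0"
      using arch_fun_generator[OF assms(3), of "\<lambda>_::'d. x"] assms(4)[OF u] x zero by (simp add: u_def)
    then have "measure M (cbox 0 u) = 0" using assms(2) u by (simp add: has_cdf_def)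
    then have null: "emeasure M (cbox 0 u) = 0"
      using assms(2) by (simp add: has_cdf_def prob_space.finite_measure finite_measure.emeasure_eq_measure)
    \<comment> \<open>A relatively open null set that contains the origin because
      \<open>\<psi> x > 0\<close>.\<close>
    define V where "V = cbox 0 1 \<inter> {v. \<forall>i. v $ i < u $ i}"
    have "open {v. \<forall>i. v $ i < u $ i}"
      unfolding Collect_all_eq by (intro open_INT ballI open_Collect_less continuous_intros finite)
    then have "openin (top_of_set (cbox 0 1)) V" unfolding V_def openin_open by blast
    moreover have "emeasure M V = 0"
    proof -
      have "V \<subseteq> cbox 0 u" by (auto simp: V_def mem_box_cart less_imp_le)
      moreover have "cbox 0 u \<in> sets M"
      proof -
        have "cbox 0 u \<subseteq> cbox 0 1" using u by (auto simp: mem_box_cart) (meson order_trans)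
        then show ?thesis using assms(2) by (auto simp: has_cdf_def sets_restrict_space_iff)
      qed
      ultimately show ?thesis using null emeasure_mono by (metis le_zero_eq)
    qed
    moreover have "0 \<in> V" using x by (simp add: V_def u_def mem_box_cart)
    ultimately show False using full msupport_eq_space_iff[of M] sp by auto
  qed
  have "\<psi> (2 ^ n) > 0" for n
  proof (induction n)
    case 0
    then show ?case using assms(3) by (simp add: generator_def)
  qed (use double in simp)
  moreover obtain n where "x < 2 ^ n" using real_arch_pow[of 2 x] by auto
  ultimately show ?thesis using anti[of x "2 ^ n"] assms(6) by (metis less_le_trans less_imp_le)
qed

theorem theorem3p6:
  fixes C :: "real^'d \<Rightarrow> real" and \<gamma> :: "real measure"
  assumes "CARD('d) \<ge> 2"
    and "C \<in> archimedean_copulas"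
    and "\<gamma> \<in> williamson_measures CARD('d)"
    and "is_williamson_measure C \<gamma>"
  shows "msupport \<gamma> = {0..} \<longleftrightarrow> msupport (copula_measure C) = cbox 0 1"
proof -
  define M where "M = copula_measure C"
  have cdf: "has_cdf M C"
    using assms(2) has_cdf_copula_measure by (auto simp: M_def archimedean_copulas_def)
  obtain \<psi> where gen: "generator \<psi>"
    and \<psi>: "\<And>z. 0 \<le> z \<Longrightarrow> \<psi> z = williamson_transform CARD('d) \<gamma> z"
    and C: "\<And>x. x \<in> cbox 0 1 \<Longrightarrow> C x = arch_fun \<psi> x"
    using assms(4) unfolding is_williamson_measure_def by blast
  note \<gamma> = assms(3)
  have sets_M: "sets M = sets (restrict_space borel (cbox 0 1))" and "prob_space M"
    using cdf by (auto simp: has_cdf_def)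
  note sp = space_has_cdf[OF cdf]
  interpret M: prob_space M by fact
  have sum_pos: "0 < (\<Sum>i\<in>UNIV. h i)" if "\<And>i::'d. 0 < h i" for h :: "'d \<Rightarrow> real"
    by (rule sum_pos) (use that in auto)
  obtain I :: "'d list" where I: "set I = UNIV" "distinct I"
    using finite_distinct_list[OF finite] by blast
  \<comment> \<open>\<open>K h a\<close> is the integrand whose \<open>\<gamma>\<close>-integral is
    the mass of the box. It takes \<open>d\<close> steps against the exponent \<open>d - 1\<close>,
    as in \<open>fdiff_kernel\<close>.\<close>
  define K where "K h a t = fdiff (map h I) (\<lambda>s. (max 0 (1 - t * s)) ^ (CARD('d) - 1)) (\<Sum>i\<in>UNIV. a i)"
    for h a :: "'d \<Rightarrow> real" and t :: real
  have K: "if t * (\<Sum>i\<in>UNIV. a i) < 1 \<and> 1 < t * ((\<Sum>i\<in>UNIV. a i) + (\<Sum>i\<in>UNIV. h i))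
           then K h a t > 0 else K h a t = 0"
    if "\<And>i. 0 < h i" "0 < t" for h a t
  proof -
    have len: "length (map h I) = Suc (CARD('d) - 1)"
      using I assms(1) distinct_card[OF I(2)] by simp
    have "sum_list (map h I) = (\<Sum>i\<in>UNIV. h i)"
      using I by (simp add: sum_list_distinct_conv_sum_set)
    then show ?thesis
      using fdiff_kernel[OF that(2) _ len, of "\<Sum>i\<in>UNIV. a i"] assms(1) that(1)
      unfolding K_def by (simp add: Suc_le_eq)
  qed
  \<comment> \<open>Positivity of \<open>\<psi>\<close> stays a premise, since the two directions
    derive it in different ways.\<close>
  have box: "measure M {u\<in>cbox 0 1. (\<forall>i. \<psi> (a i + h i) < u $ i) \<and> (\<forall>i. u $ i \<le> \<psi> (a i))}
             = (LINT t|\<gamma>. K h a t)"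
    and int: "integrable \<gamma> (K h a)"
    if "\<And>x. 0 \<le> x \<Longrightarrow> \<psi> x > 0" "\<And>i. 0 \<le> a i" "\<And>i. 0 < h i" for a h
  proof -
    have "\<forall>h\<in>set (map h I). 0 < h" using that by auto
    note * = fdiff_williamson_transform[OF \<gamma> \<psi> _ this, of "\<Sum>i\<in>UNIV. a i"]
    show "integrable \<gamma> (K h a)" unfolding K_def using * that by (simp add: sum_nonneg)
    show "measure M {u\<in>cbox 0 1. (\<forall>i. \<psi> (a i + h i) < u $ i) \<and> (\<forall>i. u $ i \<le> \<psi> (a i))}
             = (LINT t|\<gamma>. K h a t)"
      unfolding K_def using * that measure_box_fdiff[OF cdf C gen that I(2)] I(1) by (simp add: sum_nonneg)
  qed
  have "msupport M = cbox 0 1" if full: "msupport \<gamma> = {0..}"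
  proof -
    \<comment> \<open>Intervals starting at 0 are included by passing to the right half.\<close>
    have charged: "emeasure \<gamma> {a<..<b} \<noteq> 0" if "0 \<le> a" "a < b" for a b
    proof -
      have "emeasure \<gamma> {(a + b)/2<..<b} \<noteq> 0"
        using full_support_williamson_iff[OF \<gamma>] full that by simp
      moreover have "{(a + b)/2<..<b} \<subseteq> {a<..<b}" using that by auto
      ultimately show ?thesis
        using emeasure_mono greaterThanLessThan_in_sets_williamson[OF \<gamma> that(1)] by (metis le_zero_eq)
    qed
    have pos: "\<psi> x > 0" if "0 \<le> x" for x
    proof (cases "x = 0")
      case False
      then have x: "x > 0" using that by simp
      \<comment> \<open>The kernel at \<open>x\<close> is positive for \<open>t < 1/x\<close>, and
        \<gamma> charges the interval from 0 to \<open>1/x\<close>.\<close>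
      have "0 < (LINT t|\<gamma>. (max 0 (1 - t * x)) ^ (CARD('d) - 1))"
      proof (rule integral_pos_on[where A = "{0<..<1/x}"])
        show "0 < max 0 (1 - t * x) ^ (CARD('d) - 1)" if "t \<in> {0<..<1/x}" for t
          using that x by (auto simp: field_simps)
      qed (use x integrable_williamson_kernel[OF \<gamma>] charged greaterThanLessThan_in_sets_williamson[OF \<gamma>] in auto)
      then show ?thesis using \<psi> that by (simp add: williamson_transform_def)
    qed (use gen in \<open>simp add: generator_def\<close>)
    have False if U: "openin (top_of_set (cbox 0 1)) U" "emeasure M U = 0" "U \<noteq> {}" for U
    proof -
      obtain V where V: "open V" "U = cbox 0 1 \<inter> V" using U(1) by (auto simp: openin_open)
      \<comment> \<open>The open cube is dense in the closed one, so \<open>U\<close> contains a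
        closed box with corner coordinates strictly between 0 and 1, all of them values of
        \<open>\<psi>\<close> at positive arguments.\<close>
      have "box 0 (1::real^'d) \<noteq> {}" by (simp add: interval_ne_empty_cart)
      then have "closure (box 0 (1::real^'d)) = cbox 0 1" by (rule closure_box)
      then have "V \<inter> box 0 1 \<noteq> {}"
        using open_Int_closure_eq_empty[OF V(1), of "box 0 1"] U(3) V(2) by (auto simp: Int_commute)
      moreover have "open (V \<inter> box 0 1)" using V by auto
      ultimately obtain p q u where pq: "u \<in> box p q" "cbox p q \<subseteq> V \<inter> box 0 1"
        by (metis open_contains_cbox all_not_in_conv)
      have p: "0 < p $ i" and q: "q $ i < 1" and less: "p $ i < q $ i" for i
      proof -
        have *: "p $ i < q $ i" for i
          using pq(1) by (auto simp: mem_box_cart intro: less_trans)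
        then have "p \<in> cbox p q" "q \<in> cbox p q" by (auto simp: mem_box_cart less_imp_le)
        then have "p \<in> box 0 1" "q \<in> box 0 1" using pq(2) by auto
        then show "0 < p $ i" "q $ i < 1" "p $ i < q $ i" using * by (auto simp: mem_box_cart)
      qed
      \<comment> \<open>As \<open>\<psi>\<close> decreases, the upper corner \<open>q\<close> gives
        the base point \<open>a\<close> and the lower corner \<open>p\<close> gives
        \<open>a + h\<close>.\<close>
      have "\<exists>x>0. \<psi> x = q $ i" for i
        using generator_range[OF gen, of "q $ i"] p[of i] q[of i] less[of i] by (metis less_trans)
      then obtain a where a: "\<And>i. a i > 0" "\<And>i. \<psi> (a i) = q $ i" by metis
      have "\<exists>x>0. \<psi> x = p $ i" for i
        using generator_range[OF gen, of "p $ i"] p[of i] q[of i] less[of i] by (metis less_trans)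
      then obtain b where b: "\<And>i. b i > 0" "\<And>i. \<psi> (b i) = p $ i" by metis
      have "a i < b i" for i
      proof (rule ccontr)
        assume "\<not> a i < b i"
        then have "\<psi> (a i) \<le> \<psi> (b i)"
          using gen b(1)[of i] unfolding generator_def monotone_on_def by auto
        then show False using less[of i] a b by simp
      qed
      define h where "h i = b i - a i" for i
      have h: "0 < h i" for i using \<open>a i < b i\<close> by (simp add: h_def)
      define A where "A = (\<Sum>i\<in>UNIV. a i)"
      define H where "H = (\<Sum>i\<in>UNIV. h i)"
      have AH: "0 < A" "0 < H" using sum_pos a h by (auto simp: A_def H_def)
      have nn: "0 \<le> a i" for i using a(1)[of i] by simp
      have "0 < (LINT t|\<gamma>. K h a t)"
      \<comment> \<open>These are the \<open>t\<close> with \<open>A < 1/t < A + H\<close>, where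
        \<open>K h a\<close> is positive.\<close>
      proof (rule integral_pos_on[where A = "{1/(A + H)<..<1/A}"])
        show "integrable \<gamma> (K h a)" by (rule int[OF pos nn h])
        show "AE t in \<gamma>. 0 \<le> K h a t"
          using AE_williamson_pos[OF \<gamma>]
        proof eventually_elim
          case (elim t)
          then show ?case using K[of h t a, OF h elim] by (simp split: if_splits)
        qed
        show "{1/(A + H)<..<1/A} \<in> sets \<gamma>"
          using AH by (intro greaterThanLessThan_in_sets_williamson[OF \<gamma>]) simp
        show "emeasure \<gamma> {1/(A + H)<..<1/A} \<noteq> 0"
          using AH by (intro charged) (auto simp: field_simps)
        fix t assume t: "t \<in> {1/(A + H)<..<1/A}"
        have "0 < 1/(A + H)" using AH by simp
        then have "0 < t" using t by (meson greaterThanLessThan_iff less_trans)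
        moreover have "t * A < 1" "1 < t * (A + H)" using t AH by (auto simp: field_simps)
        ultimately show "0 < K h a t" using K[OF h, of t a] by (simp add: A_def H_def)
      qed
      then have "0 < measure M {u\<in>cbox 0 1. (\<forall>i. \<psi> (a i + h i) < u $ i) \<and> (\<forall>i. u $ i \<le> \<psi> (a i))}"
        using box[OF pos nn h] by simp
      also have "\<dots> \<le> measure M U"
      proof (rule M.finite_measure_mono)
        show "U \<in> sets M" using V sets_M by (auto simp: sets_restrict_space)
        show "{u\<in>cbox 0 1. (\<forall>i. \<psi> (a i + h i) < u $ i) \<and> (\<forall>i. u $ i \<le> \<psi> (a i))} \<subseteq> U"
        proof safe
          fix v :: "real^'d" assume v: "v \<in> cbox 0 1" "\<forall>i. \<psi> (a i + h i) < v $ i" "\<forall>i. v $ i \<le> \<psi> (a i)"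
          then have "v \<in> cbox p q" by (auto simp: mem_box_cart h_def a b less_imp_le)
          then show "v \<in> U" using pq v V by auto
        qed
      qed
      finally show False using U(2) by (simp add: measure_def)
    qed
    then show ?thesis using msupport_eq_space_iff[of M] unfolding sp by blast
  qed
  moreover have "msupport \<gamma> = {0..}" if full: "msupport M = cbox 0 1"
  proof -
    note pos = generator_pos_of_full_copula[OF assms(1) cdf gen C full]
    have False if ab: "0 < a" "a < b" "emeasure \<gamma> {a<..<b} = 0" for a b
    proof -
      \<comment> \<open>Summed over the \<open>d\<close> coordinates, \<open>x\<close> gives
        \<open>1/b\<close> and \<open>x + h\<close> gives \<open>1/a\<close>. Hence the kernel
        difference is nonzero only for \<open>t\<close> between \<open>a\<close> and
        \<open>b\<close>, a \<gamma>-null set, and the box has mass 0.\<close>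
      define x h where "x = 1 / b / real CARD('d)" and "h = (1 / a - 1 / b) / real CARD('d)"
      have x: "0 < x" and h: "0 < h" using ab by (auto simp: x_def h_def field_simps)
      have sums: "(\<Sum>i\<in>(UNIV::'d set). x) = 1 / b" "(\<Sum>i\<in>(UNIV::'d set). h) = 1 / a - 1 / b"
        by (auto simp: x_def h_def)
      have "{a<..<b} \<in> null_sets \<gamma>"
        using ab greaterThanLessThan_in_sets_williamson[OF \<gamma>, of a b] by auto
      then have "AE t in \<gamma>. t \<notin> {a<..<b}" by (rule AE_not_in)
      then have "AE t in \<gamma>. K (\<lambda>_. h) (\<lambda>_. x) t = 0"
        using AE_williamson_pos[OF \<gamma>]
      proof eventually_elim
        case (elim t)
        then have "\<not> (t * (1 / b) < 1 \<and> 1 < t * (1 / b + (1 / a - 1 / b)))"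
          using ab by (auto simp: field_simps)
        then show ?case using K[of "\<lambda>_. h" t "\<lambda>_. x"] h elim(2) unfolding sums by simp
      qed
      then have "(LINT t|\<gamma>. K (\<lambda>_. h) (\<lambda>_. x) t) = 0" by (rule integral_eq_zero_AE)
      then have null: "measure M {u\<in>cbox 0 1. (\<forall>i. \<psi> (x + h) < u $ i) \<and> (\<forall>i. u $ i \<le> \<psi> x)} = 0"
        using box[OF pos, of "\<lambda>_. x" "\<lambda>_. h"] x h by simp
      \<comment> \<open>The open box inside the half-open null box contradicts full support.\<close>
      define V :: "(real^'d) set" where "V = box (\<chi> i. \<psi> (x + h)) (\<chi> i. \<psi> x)"
      have lt: "\<psi> (x + h) < \<psi> x" using generator_strict[OF gen] x h pos by simp
      have "\<psi> x \<le> 1" using generator_bounds[OF gen] x by simp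
      then have V: "V \<subseteq> cbox 0 1"
        unfolding V_def using pos[of "x + h"] x h
        by (auto simp: mem_box_cart) (meson less_imp_le less_trans, meson less_imp_le less_le_trans)
      have "openin (top_of_set (cbox 0 1)) V"
        using V open_box unfolding openin_open V_def by blast
      moreover have "emeasure M V = 0"
      proof -
        have S: "{u\<in>cbox 0 1. (\<forall>i. \<psi> (x + h) < u $ i) \<and> (\<forall>i. u $ i \<le> \<psi> x)} \<in> sets M"
          using box_in_sets_has_cdf[OF cdf, of UNIV "\<lambda>_. \<psi> (x + h)" "\<lambda>_. \<psi> x"] by simp
        have "V \<subseteq> {u\<in>cbox 0 1. (\<forall>i. \<psi> (x + h) < u $ i) \<and> (\<forall>i. u $ i \<le> \<psi> x)}"
          using V by (auto simp: V_def mem_box_cart less_imp_le)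
        from M.finite_measure_mono[OF this S] null
        show ?thesis by (simp add: M.emeasure_eq_measure measure_le_0_iff)
      qed
      moreover have "V \<noteq> {}" using lt by (simp add: V_def interval_ne_empty_cart)
      ultimately show False using full msupport_eq_space_iff[of M] unfolding sp by blast
    qed
    then show ?thesis using full_support_williamson_iff[OF \<gamma>] by blast
  qed
  ultimately show ?thesis unfolding M_def by blast
qed

end
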